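(* Let $p<0$ and let $\{X_t\}_{t\ge 0}$ be the Markov chain on $[0,1]$ in which $0$ and $1$ are absorbing states and, given $X_{t-1}=x\in(0,1)$, the next state $X_t$ is uniform on $(0,x)$ with probability $\frac{x^p}{x^p+(1-x)^p}$ and uniform on $(x,1)$ with probability $\frac{(1-x)^p}{x^p+(1-x)^p}$. If the chain is started from $X_0=x\in(0,1)$, then as $t\to\infty$, $X_t$ converges almost surely to a random variable with distribution $$\operatorname{Ber}\left(\frac12-\frac{x^{p-1}-(1-x)^{p-1}}{2\left(x^p+(1-x)^p\right)^{\frac{p-1}{p}}}\right).$$
   Context: $\operatorname{Ber}(r)$ denotes the Bernoulli distribution on $\{0,1\}$ that takes the value $1$ with probability $r$ and $0$ with probability $1-r$. *)

theory Defs
  imports "HOL-Probability.Probability"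
begin

definition natural_filtration ::
  "'a measure \<Rightarrow> 'b measure \<Rightarrow> (nat \<Rightarrow> 'a \<Rightarrow> 'b) \<Rightarrow> nat \<Rightarrow> 'a measure" where
  "natural_filtration M S X t =
     sigma (space M) {X s -` B \<inter> space M | s B. s \<le> t \<and> B \<in> sets S}"

text \<open>A discrete-time homogeneous Markov chain on \<open>M\<close> with state space \<open>S\<close> and transition
  kernel \<open>K\<close>: \<open>P(X\<^sub>t\<^sub>+\<^sub>1 \<in> B | X\<^sub>0, \<dots>, X\<^sub>t) = K(X\<^sub>t, B)\<close> almost surely. The natural filtration
  is the smallest one that \<open>X\<close> is adapted to, so a chain that is Markov with respect to
  any larger filtration is covered.\<close>

definition markov_chain ::
  "'a measure \<Rightarrow> 'b measure \<Rightarrow> ('b \<Rightarrow> 'b measure) \<Rightarrow> (nat \<Rightarrow> 'a \<Rightarrow> 'b) \<Rightarrow> bool" where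
  "markov_chain M S K X \<longleftrightarrow>
     prob_space M \<and>
     (\<forall>t. X t \<in> measurable M S) \<and>
     (\<forall>t. \<forall>B\<in>sets S. AE \<omega> in M.
        real_cond_exp M (natural_filtration M S X t)
          (\<lambda>\<omega>'. indicator B (X (Suc t) \<omega>')) \<omega> = measure (K (X t \<omega>)) B)"

abbreviation unit_interval :: "real measure" where
  "unit_interval \<equiv> restrict_space borel {0..1}"

definition unif :: "real \<Rightarrow> real \<Rightarrow> real measure" where
  "unif a b = uniform_measure (restrict_space lborel {0..1}) {a<..<b}"

text \<open>The second branch is only ever used for the absorbing states \<open>0\<close> and \<open>1\<close>.\<close>

definition split_kernel :: "real \<Rightarrow> real \<Rightarrow> real measure" where
  "split_kernel p x =
     (if x \<in> {0<..<1}
      then measure_pmf (bernoulli_pmf (x powr p / (x powr p + (1 - x) powr p)))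
             \<bind> (\<lambda>left. if left then unif 0 x else unif x 1)
      else return unit_interval x)"

text \<open>\<open>bernoulli_pmf r\<close> is a distribution on \<open>bool\<close> and clamps \<open>r\<close> to \<open>[0, 1]\<close>; wherever \<open>Ber r\<close>
  is claimed to be a law, \<open>r \<in> {0..1}\<close> has to be stated separately.\<close>

definition Ber :: "real \<Rightarrow> real measure" where
  "Ber r = distr (measure_pmf (bernoulli_pmf r)) borel of_bool"

definition limit_prob :: "real \<Rightarrow> real \<Rightarrow> real" where
  "limit_prob p x =
     1 / 2 - (x powr (p - 1) - (1 - x) powr (p - 1)) /
             (2 * (x powr p + (1 - x) powr p) powr ((p - 1) / p))"

end

theory Submission
  imports Defs
begin

text \<open>On \<open>(0, 1)\<close> the chain jumps with density \<open>k(x, y) = x\<^sup>p\<^sup>-\<^sup>1 / D(x)\<close> for \<open>y < x\<close> and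
  \<open>(1 - x)\<^sup>p\<^sup>-\<^sup>1 / D(x)\<close> for \<open>y > x\<close>, where \<open>D(x) = x\<^sup>p + (1 - x)\<^sup>p\<close>. Put \<open>T = D\<^sup>1\<^sup>/\<^sup>p\<close>; it vanishes
  at \<open>0\<close> and \<open>1\<close>, and \<open>limit_prob p = 1/2 - T'/2\<close>. Since \<open>D' = p (x\<^sup>p\<^sup>-\<^sup>1 - (1 - x)\<^sup>p\<^sup>-\<^sup>1)\<close>, integrating
  \<open>u = \<alpha> + (T V)'\<close> against \<open>k(x, \<cdot>)\<close> gives \<open>u(x) - T(x) V'(x)\<close>. The choice of a constant \<open>V\<close>
  shows that \<open>limit_prob p\<close> is harmonic. The choice \<open>V' = 2 + x\<^sup>-\<^sup>p\<^sup>-\<^sup>1 + (1 - x)\<^sup>-\<^sup>p\<^sup>-\<^sup>1\<close> gives a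
  nonnegative potential whose expected one-step decrease \<open>T V'\<close> dominates, up to a constant factor,
  the expected step size \<open>E |X\<^sub>t\<^sub>+\<^sub>1 - X\<^sub>t|\<close>. Hence the steps are almost surely summable, so the chain converges, and
  \<open>T V'\<close> tends to \<open>0\<close> along it, so that the limit is \<open>0\<close> or \<open>1\<close>. The law of the limit is
  read off from the harmonic function by dominated convergence.\<close>

section \<open>The jump density and integrals of derivatives against it\<close>

text \<open>Only one-sided limits are asked for at the ends, since the formulas to be integrated are
  not valid at 0 and 1, where \<open>powr\<close> takes the conventional value
  \<open>0 powr p = 0\<close>. Integrability comes from the sign of \<open>f\<close>.\<close>

lemma nn_integral_FTC_open:
  fixes a b A B :: real and F f :: "real \<Rightarrow> real"
  assumes "a < b"
    and deriv: "\<And>y. a < y \<Longrightarrow> y < b \<Longrightarrow> (F has_real_derivative f y) (at y)"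
    and cont: "\<And>y. a < y \<Longrightarrow> y < b \<Longrightarrow> isCont f y"
    and nonneg: "\<And>y. a < y \<Longrightarrow> y < b \<Longrightarrow> 0 \<le> f y"
    and A: "(F \<longlongrightarrow> A) (at_right a)" and B: "(F \<longlongrightarrow> B) (at_left b)"
  shows "(\<integral>\<^sup>+y. ennreal (f y) * indicator {a<..<b} y \<partial>lborel) = ennreal (B - A)"
proof -
  have I: "set_integrable lborel (einterval (ereal a) (ereal b)) f"
      "(LBINT y=ereal a..ereal b. f y) = B - A"
    by (rule interval_integral_FTC_nonneg[where F = F];
        use assms in \<open>simp add: ereal_tendsto_simps\<close>)+
  then have int: "integrable lborel (\<lambda>y. indicator {a<..<b} y *\<^sub>R f y)"
    by (simp add: set_integrable_def)
  have "(\<integral>\<^sup>+y. ennreal (f y) * indicator {a<..<b} y \<partial>lborel)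
      = (\<integral>\<^sup>+y. ennreal (indicator {a<..<b} y *\<^sub>R f y) \<partial>lborel)"
    by (intro nn_integral_cong) (auto split: split_indicator)
  also have "\<dots> = ennreal (\<integral>y. indicator {a<..<b} y *\<^sub>R f y \<partial>lborel)"
    by (rule nn_integral_eq_integral[OF int]) (use nonneg in \<open>auto split: split_indicator\<close>)
  also have "(\<integral>y. indicator {a<..<b} y *\<^sub>R f y \<partial>lborel) = B - A"
    using I(2) \<open>a < b\<close>
    by (simp add: interval_lebesgue_integral_def set_lebesgue_integral_def)
  finally show ?thesis .
qed

definition power_sum :: "real \<Rightarrow> real \<Rightarrow> real" where
  "power_sum p x = x powr p + (1 - x) powr p"

definition split_density :: "real \<Rightarrow> real \<Rightarrow> real \<Rightarrow> real" where
  "split_density p x y =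
     (x powr (p - 1) * indicator {0<..<x} y + (1 - x) powr (p - 1) * indicator {x<..<1} y)
       / power_sum p x"

lemma power_sum_pos: "0 < x \<Longrightarrow> 0 < power_sum p x"
  by (simp add: power_sum_def add_pos_nonneg)

text \<open>Divided by \<open>power_sum p x\<close>, this identity says that
  \<open>split_density p x\<close> has total mass 1.\<close>

lemma power_sum_eq:
  assumes "0 < x" "x < 1"
  shows "power_sum p x = x * x powr (p - 1) + (1 - x) * (1 - x) powr (p - 1)"
  using assms by (simp add: power_sum_def powr_mult_base)

lemma power_sum_reflect: "power_sum p (1 - x) = power_sum p x"
  by (simp add: power_sum_def)

lemma split_density_nonneg: "0 < x \<Longrightarrow> 0 \<le> split_density p x y"
  using power_sum_pos[of x p] by (simp add: split_density_def)

lemma measurable_split_density [measurable]: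
  "(\<lambda>(x, y). split_density p x y) \<in> borel_measurable (borel \<Otimes>\<^sub>M borel)"
  "(\<lambda>z. split_density p (fst z) (snd z)) \<in> borel_measurable (borel \<Otimes>\<^sub>M borel)"
  "split_density p x \<in> borel_measurable borel"
  unfolding split_density_def power_sum_def indicator_def greaterThanLessThan_iff case_prod_beta
  by measurable

lemma nn_integral_split_density_add:
  assumes x: "0 < x" "x < 1" and [measurable]: "u \<in> borel_measurable borel"
  shows "(\<integral>\<^sup>+y. u y * ennreal (split_density p x y) \<partial>lborel)
    = ennreal (x powr (p - 1) / power_sum p x) * (\<integral>\<^sup>+y. u y * indicator {0<..<x} y \<partial>lborel)
    + ennreal ((1 - x) powr (p - 1) / power_sum p x) * (\<integral>\<^sup>+y. u y * indicator {x<..<1} y \<partial>lborel)"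
  (is "?l = ennreal ?a * _ + ennreal ?b * _")
proof -
  have "?l = (\<integral>\<^sup>+y. ennreal ?a * (u y * indicator {0<..<x} y)
      + ennreal ?b * (u y * indicator {x<..<1} y) \<partial>lborel)"
    by (intro nn_integral_cong)
       (auto simp: split_density_def mult_ac split: split_indicator)
  also have "\<dots> = (\<integral>\<^sup>+y. ennreal ?a * (u y * indicator {0<..<x} y) \<partial>lborel)
      + (\<integral>\<^sup>+y. ennreal ?b * (u y * indicator {x<..<1} y) \<partial>lborel)"
    by (rule nn_integral_add) measurable
  also have "\<dots> = ennreal ?a * (\<integral>\<^sup>+y. u y * indicator {0<..<x} y \<partial>lborel)
      + ennreal ?b * (\<integral>\<^sup>+y. u y * indicator {x<..<1} y \<partial>lborel)"
    by (intro arg_cong2[where f = "(+)"] nn_integral_cmult) measurable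
  finally show ?thesis .
qed

text \<open>The density is constant on each side of \<open>x\<close>, so an antiderivative
  contributes its increment \<open>U x - 0\<close> on the left and \<open>I - U x\<close> on the
  right.\<close>

lemma nn_integral_split_density:
  fixes U u :: "real \<Rightarrow> real"
  assumes x: "0 < x" "x < 1"
    and deriv: "\<And>y. 0 < y \<Longrightarrow> y < 1 \<Longrightarrow> (U has_real_derivative u y) (at y)"
    and cont: "\<And>y. 0 < y \<Longrightarrow> y < 1 \<Longrightarrow> isCont u y"
    and nonneg: "\<And>y. 0 < y \<Longrightarrow> y < 1 \<Longrightarrow> 0 \<le> u y"
    and lim: "(U \<longlongrightarrow> 0) (at_right 0)" "(U \<longlongrightarrow> I) (at_left 1)"
    and [measurable]: "u \<in> borel_measurable borel"
  shows "(\<integral>\<^sup>+y. ennreal (u y) * ennreal (split_density p x y) \<partial>lborel)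
    = ennreal ((x powr (p - 1) * U x + (1 - x) powr (p - 1) * (I - U x)) / power_sum p x)"
proof -
  have "isCont U x"
    using deriv x by (blast intro: DERIV_isCont)
  then have c: "(U \<longlongrightarrow> U x) (at_left x)" "(U \<longlongrightarrow> U x) (at_right x)"
    by (simp_all add: isCont_def filterlim_at_split)
  have l: "(\<integral>\<^sup>+y. ennreal (u y) * indicator {0<..<x} y \<partial>lborel) = ennreal (U x - 0)"
    by (rule nn_integral_FTC_open) (use assms c in auto)
  have r: "(\<integral>\<^sup>+y. ennreal (u y) * indicator {x<..<1} y \<partial>lborel) = ennreal (I - U x)"
    by (rule nn_integral_FTC_open) (use assms c in auto)
  \<comment> \<open>Monotonicity makes both increments nonnegative, so that the two
    \<open>ennreal\<close> terms can be added as real numbers.\<close>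
  have mono: "U s \<le> U t" if "0 < s" "s \<le> t" "t < 1" for s t
    by (rule DERIV_nonneg_imp_nondecreasing[OF that(2)])
       (meson deriv nonneg le_less_trans less_le_trans that)
  have "0 \<le> U x"
    using x by (intro tendsto_upperbound[OF lim(1)] eventually_at_rightI[of 0 x]) (auto intro: mono)
  moreover have "U x \<le> I"
    using x by (intro tendsto_lowerbound[OF lim(2)] eventually_at_leftI[of x 1]) (auto intro: mono)
  ultimately show ?thesis
    using power_sum_pos[OF x(1), of p] x
    by (subst nn_integral_split_density_add)
       (auto simp: l r ennreal_mult[symmetric] ennreal_plus[symmetric] add_divide_distrib simp del: ennreal_plus)
qed

section \<open>The function T and the one-step mean of \<open>\<alpha> + (T V)'\<close>\<close>

text \<open>On the open unit interval this is comparable with the distance to the boundary. At the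
  boundary only its limits are meaningful: \<open>tent p 0\<close> evaluates to 1, while the limit
  there is 0.\<close>

definition tent :: "real \<Rightarrow> real \<Rightarrow> real" where
  "tent p x = power_sum p x powr (1 / p)"

definition tent' :: "real \<Rightarrow> real \<Rightarrow> real" where
  "tent' p x = (x powr (p - 1) - (1 - x) powr (p - 1)) * power_sum p x powr (1 / p - 1)"

lemma measurable_tent [measurable]:
  "power_sum p \<in> borel_measurable borel"
  "tent p \<in> borel_measurable borel" "tent' p \<in> borel_measurable borel"
  unfolding tent_def tent'_def power_sum_def by measurable

lemma DERIV_power_sum:
  assumes "0 < x" "x < 1"
  shows "(power_sum p has_real_derivative p * (x powr (p - 1) - (1 - x) powr (p - 1))) (at x)"
proof -
  have "((\<lambda>x. x powr p + (1 - x) powr p) has_real_derivative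
      p * (x powr (p - 1) - (1 - x) powr (p - 1))) (at x)"
    using assms by (auto intro!: derivative_eq_intros simp: algebra_simps powr_diff)
  then show ?thesis
    by (simp add: power_sum_def[abs_def])
qed

lemma DERIV_tent:
  assumes "p < 0" "0 < x" "x < 1"
  shows "(tent p has_real_derivative tent' p x) (at x)"
proof -
  have "((\<lambda>x. power_sum p x powr (1 / p)) has_real_derivative
      (1 / p) * power_sum p x powr (1 / p - 1) * (p * (x powr (p - 1) - (1 - x) powr (p - 1)))) (at x)"
    using power_sum_pos[OF assms(2), of p]
    by (intro DERIV_fun_powr[THEN DERIV_cong, OF DERIV_power_sum[OF assms(2,3)]]) auto
  then show ?thesis
    using assms by (simp add: tent_def[abs_def] tent'_def mult_ac)
qed

lemma isCont_tent':
  assumes "0 < x" "x < 1"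
  shows "isCont (tent' p) x"
proof -
  have "isCont (power_sum p) x"
    using DERIV_power_sum[OF assms] by (rule DERIV_isCont)
  then show ?thesis
    using assms power_sum_pos[OF assms(1), of p] unfolding tent'_def[abs_def]
    by (auto intro!: continuous_intros)
qed

lemma tent_pos: "0 < x \<Longrightarrow> 0 < tent p x"
  using power_sum_pos[of x p] by (simp add: tent_def)

lemma tent_reflect: "tent p (1 - x) = tent p x"
  by (simp add: tent_def power_sum_reflect)

text \<open>The exponent \<open>1 / p\<close> is negative, so dropping the summand
  \<open>(1 - x) powr p\<close> can only increase the power.\<close>

lemma tent_le:
  assumes "p < 0" "0 < x"
  shows "tent p x \<le> x"
proof -
  have "tent p x \<le> (x powr p) powr (1 / p)"
    unfolding tent_def using assms by (intro powr_mono2') (auto simp: power_sum_def)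
  then show ?thesis
    using assms by (simp add: powr_powr)
qed

text \<open>On the left half \<open>x powr p\<close> is the larger summand, so
  \<open>power_sum p x\<close> is at most twice it; the negative exponent reverses the
  inequality.\<close>

lemma tent_ge:
  assumes "p < 0" "0 < x" "x \<le> 1 / 2"
  shows "2 powr (1 / p) * x \<le> tent p x"
proof -
  have "(1 - x) powr p \<le> x powr p"
    using assms by (intro powr_mono2') auto
  then have "(2 * x powr p) powr (1 / p) \<le> tent p x"
    unfolding tent_def using assms power_sum_pos[OF assms(2), of p]
    by (intro powr_mono2') (auto simp: power_sum_def)
  then show ?thesis
    using assms by (simp add: powr_powr powr_mult)
qed

text \<open>By \<open>tent_le\<close> and reflection, \<open>tent p x\<close> is at most the
  distance to either endpoint, which squeezes the product. Hence \<open>T V\<close> adds nothing to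
  the boundary values of an antiderivative.\<close>

lemma tent_mult_bounded_tendsto:
  assumes "p < 0" and V: "\<And>x. 0 < x \<Longrightarrow> x < 1 \<Longrightarrow> \<bar>V x\<bar> \<le> c"
  shows "((\<lambda>x. tent p x * V x) \<longlongrightarrow> 0) (at_right 0)"
    and "((\<lambda>x. tent p x * V x) \<longlongrightarrow> 0) (at_left 1)"
proof -
  have bound: "\<bar>tent p x * V x\<bar> \<le> c * x" "\<bar>tent p x * V x\<bar> \<le> c * (1 - x)"
    if "0 < x" "x < 1" for x
  proof -
    have "tent p x \<le> x" "tent p x \<le> 1 - x" "0 < tent p x" "\<bar>V x\<bar> \<le> c"
      using that assms tent_le[of p x] tent_le[of p "1 - x"] tent_pos[of x p]
      by (auto simp: tent_reflect)
    then show "\<bar>tent p x * V x\<bar> \<le> c * x" "\<bar>tent p x * V x\<bar> \<le> c * (1 - x)"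
      using that by (auto simp: abs_mult mult.commute[of c] intro!: mult_mono)
  qed
  have "((\<lambda>x::real. c * x) \<longlongrightarrow> c * 0) (at_right 0)"
    "((\<lambda>x::real. c * (1 - x)) \<longlongrightarrow> c * (1 - 1)) (at_left 1)"
    by (intro tendsto_intros)+
  then show "((\<lambda>x. tent p x * V x) \<longlongrightarrow> 0) (at_right 0)"
    "((\<lambda>x. tent p x * V x) \<longlongrightarrow> 0) (at_left 1)"
    by (auto elim!: Lim_null_comparison[rotated] simp: bound
        intro: eventually_at_rightI[of 0 1] eventually_at_leftI[of 0 1])
qed

text \<open>The antiderivative \<open>\<alpha> y + T V\<close> has boundary values 0 and
  \<open>\<alpha>\<close>. Its linear part returns \<open>\<alpha>\<close> because the density has
  mass 1; the part \<open>T V\<close> returns \<open>V x\<close> times the difference of the two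
  density levels times \<open>tent p x\<close>, and that product of levels and tent is
  \<open>tent' p x\<close>.\<close>

lemma nn_integral_split_density_tent:
  assumes p: "p < 0" and x: "0 < x" "x < 1"
    and deriv: "\<And>y. 0 < y \<Longrightarrow> y < 1 \<Longrightarrow> (V has_real_derivative V' y) (at y)"
    and cont: "\<And>y. 0 < y \<Longrightarrow> y < 1 \<Longrightarrow> isCont V' y"
    and bound: "\<And>y. 0 < y \<Longrightarrow> y < 1 \<Longrightarrow> \<bar>V y\<bar> \<le> c"
    and nonneg: "\<And>y. 0 < y \<Longrightarrow> y < 1 \<Longrightarrow> 0 \<le> \<alpha> + tent' p y * V y + tent p y * V' y"
    and [measurable]: "V \<in> borel_measurable borel" "V' \<in> borel_measurable borel"
  shows "(\<integral>\<^sup>+y. ennreal (\<alpha> + tent' p y * V y + tent p y * V' y) * ennreal (split_density p x y) \<partial>lborel)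
    = ennreal (\<alpha> + tent' p x * V x)"
proof -
  define U where "U y = \<alpha> * y + tent p y * V y" for y
  have U: "(U has_real_derivative \<alpha> + tent' p y * V y + tent p y * V' y) (at y)"
    if "0 < y" "y < 1" for y
    unfolding U_def[abs_def]
    by (auto intro!: derivative_eq_intros DERIV_tent deriv p that)
  have lim: "((\<lambda>y. \<alpha> * y + tent p y * V y) \<longlongrightarrow> \<alpha> * 0 + 0) (at_right 0)"
    "((\<lambda>y. \<alpha> * y + tent p y * V y) \<longlongrightarrow> \<alpha> * 1 + 0) (at_left 1)"
    by (intro tendsto_intros tent_mult_bounded_tendsto[OF p bound]; assumption)
      (intro tendsto_intros tent_mult_bounded_tendsto[OF p bound]; assumption)
  have "(\<integral>\<^sup>+y. ennreal (\<alpha> + tent' p y * V y + tent p y * V' y) * ennreal (split_density p x y) \<partial>lborel)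
    = ennreal ((x powr (p - 1) * U x + (1 - x) powr (p - 1) * (\<alpha> - U x)) / power_sum p x)"
  proof (rule nn_integral_split_density[OF x U _ nonneg])
    show "(U \<longlongrightarrow> 0) (at_right 0)" "(U \<longlongrightarrow> \<alpha>) (at_left 1)"
      using lim by (simp_all add: U_def[abs_def])
    show "isCont (\<lambda>y. \<alpha> + tent' p y * V y + tent p y * V' y) y" if "0 < y" "y < 1" for y
      using that DERIV_isCont[OF DERIV_tent[OF p that]] DERIV_isCont[OF deriv[OF that]]
      by (intro continuous_intros isCont_tent' cont)
  qed measurable
  also have "(x powr (p - 1) * U x + (1 - x) powr (p - 1) * (\<alpha> - U x)) / power_sum p x
      = \<alpha> + tent' p x * V x"
  proof -
    have D: "power_sum p x > 0" "x powr (p - 1) * x + (1 - x) powr (p - 1) * (1 - x) = power_sum p x"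
      using power_sum_pos[of x p] power_sum_eq[of x p] x by (simp_all add: mult_ac)
    have "x powr (p - 1) * U x + (1 - x) powr (p - 1) * (\<alpha> - U x)
      = \<alpha> * (x powr (p - 1) * x + (1 - x) powr (p - 1) * (1 - x))
        + (x powr (p - 1) - (1 - x) powr (p - 1)) * tent p x * V x"
      by (simp add: U_def algebra_simps)
    \<comment> \<open>Here \<open>tent p x / power_sum p x\<close> is
      \<open>power_sum p x powr (1 / p - 1)\<close>, the second factor of
      \<open>tent'\<close>.\<close>
    also have "\<dots> = \<alpha> * power_sum p x + power_sum p x * tent' p x * V x"
      using D(1) unfolding D(2) by (simp add: tent_def tent'_def powr_diff)
    finally show ?thesis
      using D(1) by (simp add: field_simps)
  qed
  finally show ?thesis .
qed

section \<open>The harmonic function: bounds and boundary values\<close>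

definition left_prob :: "real \<Rightarrow> real \<Rightarrow> real" where
  "left_prob p x = x powr p / (x powr p + (1 - x) powr p)"

lemma left_prob_bounds: "0 \<le> left_prob p x" "left_prob p x \<le> 1"
proof -
  have "0 \<le> x powr p" "0 \<le> (1 - x) powr p"
    by simp_all
  then show "0 \<le> left_prob p x" "left_prob p x \<le> 1"
    unfolding left_prob_def by (auto simp: divide_le_eq simp del: powr_ge_zero)
qed

lemma left_prob_reflect:
  assumes "0 < x" shows "left_prob p (1 - x) = 1 - left_prob p x"
  using power_sum_pos[OF assms, of p] by (simp add: left_prob_def power_sum_def field_simps)

text \<open>Dividing numerator and denominator by \<open>x powr p\<close> leaves the ratio
  \<open>x / (1 - x)\<close>, which tends to 0, under the positive exponent
  \<open>- p\<close>.\<close>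

lemma left_prob_tendsto_0:
  assumes "p < 0"
  shows "(left_prob p \<longlongrightarrow> 1) (at_right 0)"
proof -
  have "((\<lambda>x::real. 1 / (1 + (x / (1 - x)) powr (- p))) \<longlongrightarrow> 1 / (1 + (0 / (1 - 0)) powr (- p))) (at_right 0)"
    using assms
    by (intro tendsto_intros tendsto_powr')
       (auto intro!: eventually_at_rightI[of 0 1])
  moreover have "eventually (\<lambda>x. 1 / (1 + (x / (1 - x)) powr (- p)) = left_prob p x) (at_right 0)"
    by (rule eventually_at_rightI[of 0 1])
       (auto simp: left_prob_def powr_divide powr_minus field_simps)
  ultimately show ?thesis
    using assms by (auto intro: Lim_transform_eventually)
qed

lemma left_prob_tendsto_1:
  assumes "p < 0"
  shows "(left_prob p \<longlongrightarrow> 0) (at_left 1)"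
proof -
  have "filterlim (\<lambda>x. 1 - x) (at_right 0) (at_left (1::real))"
    by (auto simp: filterlim_at intro!: tendsto_eq_intros eventually_at_leftI[of 0])
  then have "((\<lambda>x. 1 - left_prob p (1 - x)) \<longlongrightarrow> 1 - 1) (at_left 1)"
    by (intro tendsto_intros filterlim_compose[OF left_prob_tendsto_0[OF assms]])
  moreover have "eventually (\<lambda>x. 1 - left_prob p (1 - x) = left_prob p x) (at_left 1)"
    by (rule eventually_at_leftI[of 0 1]) (simp_all add: left_prob_reflect)
  ultimately show ?thesis
    by (auto intro: Lim_transform_eventually)
qed

text \<open>The factor \<open>power_sum p x powr (1 / p - 1)\<close> normalises both powers, since
  \<open>(p - 1) / p = 1 - 1 / p\<close>. In terms of \<open>left_prob\<close> the exponent is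
  positive, so bounds and boundary limits can be read off.\<close>

lemma tent'_eq:
  assumes "p < 0" "0 < x" "x < 1"
  shows "tent' p x = left_prob p x powr (1 - 1 / p) - (1 - left_prob p x) powr (1 - 1 / p)"
proof -
  have *: "(z powr p / power_sum p x) powr (1 - 1 / p) = z powr (p - 1) * power_sum p x powr (1 / p - 1)"
    if "0 < z" for z
    using assms that power_sum_pos[of x p]
    by (simp add: powr_divide powr_powr right_diff_distrib powr_diff)
  have "left_prob p x = x powr p / power_sum p x" "1 - left_prob p x = (1 - x) powr p / power_sum p x"
    using power_sum_pos[of x p] assms by (simp_all add: left_prob_def power_sum_def field_simps)
  then show ?thesis
    using assms by (simp only: *) (simp add: * tent'_def left_diff_distrib)
qed

text \<open>By \<open>tent'_eq\<close> this is a difference of two numbers in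
  \<open>[0, 1]\<close>.\<close>

lemma tent'_bound:
  assumes "p < 0" "0 < x" "x < 1"
  shows "\<bar>tent' p x\<bar> \<le> 1"
proof -
  have "0 \<le> q powr (1 - 1 / p)" "q powr (1 - 1 / p) \<le> 1" if "0 \<le> q" "q \<le> 1" for q :: real
    using that assms powr_mono2[of "1 - 1 / p" q 1] by (auto simp: field_simps)
  from this[of "left_prob p x"] this[of "1 - left_prob p x"] show ?thesis
    using left_prob_bounds[of p x] unfolding tent'_eq[OF assms] by linarith
qed

lemma limit_prob_eq:
  assumes "p < 0" "0 < x"
  shows "limit_prob p x = 1 / 2 - tent' p x / 2"
proof -
  have "1 / p - 1 = - ((p - 1) / p)"
    using assms by (simp add: field_simps)
  then have "power_sum p x powr (1 / p - 1) = 1 / power_sum p x powr ((p - 1) / p)"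
    by (simp only: powr_minus_divide)
  then show ?thesis
    unfolding limit_prob_def tent'_def power_sum_def by simp
qed

lemma limit_prob_bounds:
  assumes "p < 0" "0 < x" "x < 1"
  shows "0 \<le> limit_prob p x" "limit_prob p x \<le> 1"
  using tent'_bound[OF assms] assms by (simp_all add: limit_prob_eq abs_le_iff)

lemma measurable_limit_prob [measurable]: "limit_prob p \<in> borel_measurable borel"
  unfolding limit_prob_def by measurable

text \<open>These boundary values turn \<open>limit_prob p\<close>, evaluated along a path that
  converges to 0 or 1, into the indicator of the limit being 1.\<close>

lemma limit_prob_tendsto:
  assumes "p < 0"
  shows "(limit_prob p \<longlongrightarrow> 0) (at_right 0)" "(limit_prob p \<longlongrightarrow> 1) (at_left 1)"
proof -
  define e where "e = 1 - 1 / p"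
  have e: "e > 0"
    using assms by (simp add: e_def field_simps)
  have lim: "((\<lambda>x. 1 / 2 - (left_prob p x powr e - (1 - left_prob p x) powr e) / 2) \<longlongrightarrow>
      1 / 2 - (q powr e - (1 - q) powr e) / 2) F" if "(left_prob p \<longlongrightarrow> q) F" for q F
    using e that left_prob_bounds[of p] by (intro tendsto_intros tendsto_powr') auto
  have eq: "1 / 2 - (left_prob p x powr e - (1 - left_prob p x) powr e) / 2 = limit_prob p x"
    if "0 < x" "x < 1" for x
    using assms that by (simp add: limit_prob_eq tent'_eq e_def)
  show "(limit_prob p \<longlongrightarrow> 0) (at_right 0)"
    by (rule Lim_transform_eventually[OF lim[OF left_prob_tendsto_0[OF assms], simplified]])
       (auto intro!: eventually_at_rightI[of 0 1] simp: eq)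
  show "(limit_prob p \<longlongrightarrow> 1) (at_left 1)"
    by (rule Lim_transform_eventually[OF lim[OF left_prob_tendsto_1[OF assms], simplified]])
       (auto intro!: eventually_at_leftI[of 0 1] simp: eq)
qed

lemma limit_prob_harmonic:
  assumes "p < 0" "0 < x" "x < 1"
  shows "(\<integral>\<^sup>+y. ennreal (limit_prob p y) * ennreal (split_density p x y) \<partial>lborel)
    = ennreal (limit_prob p x)"
proof -
  have nonneg: "0 \<le> 1 / 2 + tent' p y * (- 1 / 2) + tent p y * 0" if "0 < y" "y < 1" for y
    using tent'_bound[OF assms(1) that] by (simp add: abs_le_iff)
  \<comment> \<open>The instance is \<open>\<alpha> = 1 / 2\<close>, \<open>V = - 1 / 2\<close>,
    \<open>V' = 0\<close>. The two integrands need to agree only on the open unit interval, as the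
    density vanishes elsewhere.\<close>
  have "(\<integral>\<^sup>+y. ennreal (limit_prob p y) * ennreal (split_density p x y) \<partial>lborel)
    = (\<integral>\<^sup>+y. ennreal (1 / 2 + tent' p y * (- 1 / 2) + tent p y * 0) * ennreal (split_density p x y) \<partial>lborel)"
    using assms by (intro nn_integral_cong)
      (auto simp: split_density_def limit_prob_eq split: split_indicator)
  also have "\<dots> = ennreal (1 / 2 + tent' p x * (- 1 / 2))"
    by (rule nn_integral_split_density_tent[where c = "1 / 2"])
       (use assms nonneg in auto)
  finally show ?thesis
    using assms by (simp add: limit_prob_eq)
qed

section \<open>The potential and its control of the step size\<close>

text \<open>This is \<open>T V'\<close>. Near an endpoint the constant 2 in \<open>V'\<close> pays
  for jumps towards that endpoint, and the power that belongs to that endpoint pays for the rare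
  jumps away from it.\<close>

definition loss :: "real \<Rightarrow> real \<Rightarrow> real" where
  "loss p x = tent p x * (2 + x powr (- p - 1) + (1 - x) powr (- p - 1))"

text \<open>This is \<open>\<alpha> + (T V)'\<close>, with the antiderivative \<open>V\<close> of
  \<open>V'\<close> chosen to be odd about \<open>1 / 2\<close>. The constant
  \<open>\<alpha> = 1 - 1 / p\<close> is a bound on \<open>\<bar>V\<bar>\<close>; as
  \<open>\<bar>tent'\<bar> \<le> 1\<close>, it compensates the term \<open>T' V\<close>.\<close>

definition potential :: "real \<Rightarrow> real \<Rightarrow> real" where
  "potential p x = (1 - 1 / p) + tent' p x * (2 * x - 1 - (x powr - p - (1 - x) powr - p) / p) + loss p x"

lemma measurable_loss [measurable]: "loss p \<in> borel_measurable borel"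
  "potential p \<in> borel_measurable borel"
  unfolding loss_def potential_def by measurable

lemma loss_pos: "0 < x \<Longrightarrow> 0 < loss p x"
  using tent_pos[of x p] by (simp add: loss_def add_pos_nonneg)

lemma isCont_loss:
  assumes "p < 0" "0 < x" "x < 1"
  shows "isCont (loss p) x"
  unfolding loss_def[abs_def] using assms DERIV_isCont[OF DERIV_tent[OF assms]]
  by (auto intro!: continuous_intros)

lemma potential_bounds:
  assumes "p < 0" "0 < x" "x < 1"
  shows "\<bar>2 * x - 1 - (x powr - p - (1 - x) powr - p) / p\<bar> \<le> 1 - 1 / p"
    and "loss p x \<le> potential p x"
proof -
  have "0 \<le> x powr - p" "x powr - p \<le> 1" "0 \<le> (1 - x) powr - p" "(1 - x) powr - p \<le> 1"
    using assms powr_mono2[of "- p" x 1] powr_mono2[of "- p" "1 - x" 1] by auto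
  then have "\<bar>x powr - p - (1 - x) powr - p\<bar> \<le> 1"
    by linarith
  then have "\<bar>(x powr - p - (1 - x) powr - p) / p\<bar> \<le> - 1 / p"
    using assms by (simp add: abs_divide divide_le_eq le_divide_eq)
  moreover have "\<bar>2 * x - 1\<bar> \<le> 1"
    using assms by (simp add: abs_le_iff)
  ultimately show *: "\<bar>2 * x - 1 - (x powr - p - (1 - x) powr - p) / p\<bar> \<le> 1 - 1 / p"
    using abs_triangle_ineq4[of "2 * x - 1" "(x powr - p - (1 - x) powr - p) / p"] by linarith
  have "\<bar>tent' p x * (2 * x - 1 - (x powr - p - (1 - x) powr - p) / p)\<bar> \<le> 1 * (1 - 1 / p)"
    unfolding abs_mult using * tent'_bound[OF assms] by (intro mult_mono) auto
  then show "loss p x \<le> potential p x"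
    by (simp add: potential_def abs_le_iff)
qed

text \<open>With this \<open>V\<close>, the one-step mean \<open>\<alpha> + T' V\<close> is the
  potential without its last summand. The loss is added on the left to avoid truncated subtraction
  in \<open>ennreal\<close>.\<close>

lemma potential_drop:
  assumes "p < 0" "0 < x" "x < 1"
  shows "(\<integral>\<^sup>+y. ennreal (potential p y) * ennreal (split_density p x y) \<partial>lborel) + ennreal (loss p x)
    = ennreal (potential p x)"
proof -
  let ?V = "\<lambda>x. 2 * x - 1 - (x powr - p - (1 - x) powr - p) / p"
  let ?V' = "\<lambda>x. 2 + x powr (- p - 1) + (1 - x) powr (- p - 1)"
  have "(\<integral>\<^sup>+y. ennreal (potential p y) * ennreal (split_density p x y) \<partial>lborel)
    = (\<integral>\<^sup>+y. ennreal ((1 - 1 / p) + tent' p y * ?V y + tent p y * ?V' y)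
        * ennreal (split_density p x y) \<partial>lborel)"
    by (simp add: potential_def loss_def)
  also have "\<dots> = ennreal ((1 - 1 / p) + tent' p x * ?V x)"
  proof (rule nn_integral_split_density_tent[OF assms, where c = "1 - 1 / p"])
    fix y :: real assume y: "0 < y" "y < 1"
    show "(?V has_real_derivative ?V' y) (at y)"
      using y assms by (auto intro!: derivative_eq_intros simp: field_simps powr_diff)
    show "isCont ?V' y"
      using y by (auto intro!: continuous_intros)
    show "\<bar>?V y\<bar> \<le> 1 - 1 / p"
      using potential_bounds[OF assms(1) y] by simp
    show "0 \<le> 1 - 1 / p + tent' p y * ?V y + tent p y * ?V' y"
      using potential_bounds[OF assms(1) y] loss_pos[OF y(1), of p]
      by (simp add: potential_def loss_def)
  qed measurable
  also have "\<dots> = ennreal (potential p x - loss p x)"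
    by (simp add: potential_def)
  finally show ?thesis
    using potential_bounds(2)[OF assms] loss_pos[OF assms(2), of p]
    by (simp add: ennreal_plus[symmetric] del: ennreal_plus)
qed

text \<open>The left side bounds the mean step size by counting each jump with the full length of
  the interval it lands in. On the left half the factor \<open>2 powr - p\<close> comes from
  \<open>(1 - x) powr p \<le> (1 / 2) powr p\<close>, and \<open>2 powr (- 1 / p)\<close> from
  inverting \<open>tent_ge\<close>; the right half follows by reflection.\<close>

lemma mean_displacement_le:
  assumes "p < 0" "0 < x" "x < 1"
  shows "(x * x powr p + (1 - x) * (1 - x) powr p) / power_sum p x
    \<le> 2 powr (- p - 1 / p) * loss p x"
proof -
  have *: "(x * x powr p + (1 - x) * (1 - x) powr p) / power_sum p x
    \<le> 2 powr (- p - 1 / p) * loss p x" if x: "0 < x" "x \<le> 1 / 2" for x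
  proof -
    have D: "x powr p \<le> power_sum p x" "0 < power_sum p x"
      using power_sum_pos[OF x(1), of p] by (auto simp: power_sum_def)
    have "(1 - x) powr p \<le> (1 / 2) powr p"
      using x assms by (intro powr_mono2') auto
    then have "(1 - x) * (1 - x) powr p \<le> 1 * (1 / 2) powr p"
      using x by (intro mult_mono) auto
    then have "(1 - x) * (1 - x) powr p / power_sum p x \<le> (1 / 2) powr p / x powr p"
      using D x by (intro frac_le) auto
    also have "\<dots> = 2 powr - p * x powr - p"
      by (simp add: powr_divide powr_minus_divide)
    finally have 1: "(1 - x) * (1 - x) powr p / power_sum p x \<le> 2 powr - p * x powr - p" .
    have "x * x powr p / power_sum p x \<le> x * 1"
      unfolding times_divide_eq_right[symmetric] using D x by (intro mult_left_mono) auto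
    also have "\<dots> \<le> 2 powr - p * (2 * x)"
      using x assms ge_one_powr_ge_zero[of 2 "- p"] mult_mono[of 1 "2 powr - p" x "2 * x"] by simp
    finally have 2: "x * x powr p / power_sum p x \<le> 2 powr - p * (2 * x)" .
    \<comment> \<open>The left side is rewritten below as the sum of the right sides of facts
      \<open>2\<close> and \<open>1\<close>.\<close>
    have "2 powr (- p) * (2 powr (- 1 / p) * (2 powr (1 / p) * x * (2 + x powr (- p - 1))))
      \<le> 2 powr (- p) * (2 powr (- 1 / p) * (tent p x * (2 + x powr (- p - 1) + (1 - x) powr (- p - 1))))"
      using x assms by (intro mult_left_mono mult_mono tent_ge) (auto intro: less_imp_le tent_pos)
    also have "\<dots> = 2 powr (- p - 1 / p) * loss p x"
      by (simp add: loss_def powr_diff powr_minus field_simps)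
    also have "2 powr (- p) * (2 powr (- 1 / p) * (2 powr (1 / p) * x * (2 + x powr (- p - 1))))
        = 2 powr - p * (2 * x) + 2 powr - p * x powr - p"
      using x by (simp add: powr_minus powr_diff field_simps)
    finally show ?thesis
      using 1 2 by (simp add: add_divide_distrib)
  qed
  show ?thesis
  proof (cases "x \<le> 1 / 2")
    case True
    then show ?thesis using * assms by simp
  next
    case False
    then have "(x * x powr p + (1 - x) * (1 - x) powr p) / power_sum p (1 - x)
      \<le> 2 powr (- p - 1 / p) * loss p (1 - x)"
      using *[of "1 - x"] assms by (simp add: add_ac)
    then show ?thesis
      by (simp add: power_sum_reflect loss_def tent_reflect add_ac)
  qed
qed

lemma nn_integral_split_density_displacement:
  assumes "p < 0" "0 < x" "x < 1"
  shows "(\<integral>\<^sup>+y. ennreal \<bar>y - x\<bar> * ennreal (split_density p x y) \<partial>lborel)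
    \<le> ennreal (2 powr (- p - 1 / p) * loss p x)"
proof -
  have D: "0 < power_sum p x" using power_sum_pos assms by blast
  have l: "(\<integral>\<^sup>+y. ennreal \<bar>y - x\<bar> * indicator {0<..<x} y \<partial>lborel) \<le> ennreal (x * x)"
  proof -
    have "(\<integral>\<^sup>+y. ennreal \<bar>y - x\<bar> * indicator {0<..<x} y \<partial>lborel)
      \<le> (\<integral>\<^sup>+y. ennreal x * indicator {0<..<x} y \<partial>lborel)"
      by (intro nn_integral_mono) (auto split: split_indicator simp: ennreal_leI)
    also have "\<dots> = ennreal (x * x)"
      using assms by (simp add: nn_integral_cmult_indicator ennreal_mult)
    finally show ?thesis .
  qed
  have r: "(\<integral>\<^sup>+y. ennreal \<bar>y - x\<bar> * indicator {x<..<1} y \<partial>lborel) \<le> ennreal ((1 - x) * (1 - x))"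
  proof -
    have "(\<integral>\<^sup>+y. ennreal \<bar>y - x\<bar> * indicator {x<..<1} y \<partial>lborel)
      \<le> (\<integral>\<^sup>+y. ennreal (1 - x) * indicator {x<..<1} y \<partial>lborel)"
      by (intro nn_integral_mono) (auto split: split_indicator simp: ennreal_leI)
    also have "\<dots> = ennreal ((1 - x) * (1 - x))"
      using assms by (simp add: nn_integral_cmult_indicator ennreal_mult)
    finally show ?thesis .
  qed
  have "(\<integral>\<^sup>+y. ennreal \<bar>y - x\<bar> * ennreal (split_density p x y) \<partial>lborel)
    \<le> ennreal (x powr (p - 1) / power_sum p x) * ennreal (x * x)
      + ennreal ((1 - x) powr (p - 1) / power_sum p x) * ennreal ((1 - x) * (1 - x))"
    using l r assms by (subst nn_integral_split_density_add) (auto intro!: add_mono mult_left_mono)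
  also have "\<dots> = ennreal ((x * x powr p + (1 - x) * (1 - x) powr p) / power_sum p x)"
  proof -
    have "x powr (p - 1) * (x * x) = x * x powr p"
      "(1 - x) powr (p - 1) * ((1 - x) * (1 - x)) = (1 - x) * (1 - x) powr p"
      using assms by (simp_all add: powr_diff)
    then have "x powr (p - 1) / power_sum p x * (x * x)
        + (1 - x) powr (p - 1) / power_sum p x * ((1 - x) * (1 - x))
      = (x * x powr p + (1 - x) * (1 - x) powr p) / power_sum p x"
      by (simp only: times_divide_eq_left add_divide_distrib)
    moreover have "0 \<le> x powr (p - 1) / power_sum p x" "0 \<le> (1 - x) powr (p - 1) / power_sum p x"
      using D by simp_all
    ultimately show ?thesis
      using assms by (simp only: ennreal_mult[symmetric] ennreal_plus[symmetric]
          mult_nonneg_nonneg less_imp_le diff_gt_0_iff_gt)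
  qed
  also have "\<dots> \<le> ennreal (2 powr (- p - 1 / p) * loss p x)"
    using mean_displacement_le[OF assms] by (rule ennreal_leI)
  finally show ?thesis .
qed

section \<open>The transition kernel as a density\<close>

lemma unif_emeasure:
  assumes "0 \<le> a" "a < b" "b \<le> 1" and B: "B \<in> sets unit_interval"
  shows "emeasure (unif a b) B = ennreal (1 / (b - a)) * emeasure lborel ({a<..<b} \<inter> B)"
proof -
  have B': "B \<in> sets borel"
    using B by (auto simp: sets_restrict_space_iff)
  have sub: "{a<..<b} \<subseteq> {0..1}"
    using assms by auto
  have ab: "{a<..<b} \<in> sets (restrict_space lborel {0..1})"
    using sub by (auto simp: sets_restrict_space_iff)
  have "B \<in> sets (restrict_space lborel {0..1})"
    using B by (auto simp: sets_restrict_space_iff)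
  moreover have "emeasure (restrict_space lborel {0..1}) C = emeasure lborel C" if "C \<subseteq> {a<..<b}" for C
    using that sub by (intro emeasure_restrict_space) auto
  ultimately have "emeasure (unif a b) B = emeasure lborel ({a<..<b} \<inter> B) / ennreal (b - a)"
    using ab assms by (simp add: unif_def)
  also have "\<dots> = emeasure lborel ({a<..<b} \<inter> B) * ennreal (1 / (b - a))"
    using assms by (simp add: divide_ennreal_def inverse_ennreal inverse_eq_divide)
  finally show ?thesis
    by (simp add: mult.commute)
qed

lemma unif_in_subprob_algebra:
  assumes "0 \<le> a" "a < b" "b \<le> 1"
  shows "unif a b \<in> space (subprob_algebra unit_interval)"
proof -
  have s: "sets (unif a b) = sets unit_interval"
    by (simp add: unif_def sets_restrict_space)
  have "space (unif a b) = {0..1}"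
    by (simp add: unif_def space_restrict_space)
  moreover have "{0..1} \<in> sets unit_interval"
    by (simp add: sets_restrict_space_iff)
  moreover have "{a<..<b} \<inter> {0..1} = {a<..<b}"
    using assms by auto
  ultimately have "emeasure (unif a b) (space (unif a b)) = 1"
    using assms by (simp add: unif_emeasure ennreal_mult[symmetric])
  then have "subprob_space (unif a b)"
    by (intro prob_space_imp_subprob_space prob_spaceI)
  then show ?thesis
    by (simp add: space_subprob_algebra s)
qed

text \<open>A branch probability divided by the length of its interval is the level of
  \<open>split_density\<close> there; for the left branch,
  \<open>x powr p / x = x powr (p - 1)\<close>.\<close>

lemma emeasure_split_kernel:
  assumes "0 < x" "x < 1" and B: "B \<in> sets unit_interval"
  shows "emeasure (split_kernel p x) B
    = (\<integral>\<^sup>+y. indicator B y * ennreal (split_density p x y) \<partial>lborel)"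
proof -
  have [measurable]: "B \<in> sets borel"
    using B by (auto simp: sets_restrict_space_iff)
  have D: "0 < power_sum p x" using power_sum_pos assms by blast
  have q: "x powr p / power_sum p x / x = x powr (p - 1) / power_sum p x"
    "(1 - x powr p / power_sum p x) / (1 - x) = (1 - x) powr (p - 1) / power_sum p x"
    "1 - x powr p / power_sum p x \<ge> 0"
    using assms D by (auto simp: powr_diff power_sum_def field_simps)
  have "emeasure (split_kernel p x) B =
    (\<integral>\<^sup>+left. emeasure (if left then unif 0 x else unif x 1) B
       \<partial>measure_pmf (bernoulli_pmf (x powr p / power_sum p x)))"
    unfolding split_kernel_def power_sum_def using assms
    by (simp, intro emeasure_bind[where N = unit_interval])
       (auto intro!: unif_in_subprob_algebra)
  also have "\<dots> = ennreal (x powr p / power_sum p x) * emeasure (unif 0 x) B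
      + ennreal (1 - x powr p / power_sum p x) * emeasure (unif x 1) B"
    using q(3) D by (simp add: mult.commute)
  also have "\<dots> = ennreal (x powr p / power_sum p x / x) * emeasure lborel ({0<..<x} \<inter> B)
      + ennreal ((1 - x powr p / power_sum p x) / (1 - x)) * emeasure lborel ({x<..<1} \<inter> B)"
    using assms q(3) D
    by (simp add: unif_emeasure mult.assoc[symmetric] ennreal_mult[symmetric] del: mult.assoc)
  also have "\<dots> = (\<integral>\<^sup>+y. indicator B y * ennreal (split_density p x y) \<partial>lborel)"
  proof -
    have "(\<integral>\<^sup>+y. indicator B y * indicator A y \<partial>lborel) = emeasure lborel (A \<inter> B)"
      if [measurable]: "A \<in> sets borel" for A :: "real set"
    proof -
      have "(\<integral>\<^sup>+y. indicator B y * indicator A y \<partial>lborel) = (\<integral>\<^sup>+y. indicator (A \<inter> B) y \<partial>lborel)"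
        by (intro nn_integral_cong) (auto split: split_indicator)
      then show ?thesis
        by simp
    qed
    then show ?thesis
      using assms unfolding q by (subst nn_integral_split_density_add) auto
  qed
  finally show ?thesis .
qed

section \<open>From the Markov property to one-step integrals\<close>

lemma subalgebra_natural_filtration:
  assumes "\<And>t. X t \<in> measurable M S"
  shows "subalgebra M (natural_filtration M S X t)"
    and "X t \<in> measurable (natural_filtration M S X t) S"
proof -
  let ?E = "{X s -` B \<inter> space M | s B. s \<le> t \<and> B \<in> sets S}"
  have "?E \<subseteq> Pow (space M)"
    by auto
  then have s: "sets (natural_filtration M S X t) = sigma_sets (space M) ?E"
      "space (natural_filtration M S X t) = space M"
    by (simp_all add: natural_filtration_def space_measure_of)
  show "subalgebra M (natural_filtration M S X t)"
    using assms unfolding subalgebra_def s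
    by (auto intro!: sets.sigma_sets_subset)
  show "X t \<in> measurable (natural_filtration M S X t) S"
    using measurable_space[OF assms] by (intro measurableI) (auto simp: s intro!: sigma_sets.Basic)
qed

text \<open>The conditional expectation is tested against the event
  \<open>X t \<omega> \<in> A\<close>, which belongs to the filtration at time
  \<open>t\<close>.\<close>

lemma markov_chain_joint:
  assumes mc: "markov_chain M S K X" and A: "A \<in> sets S" and B: "B \<in> sets S"
  shows "emeasure M {\<omega> \<in> space M. X t \<omega> \<in> A \<and> X (Suc t) \<omega> \<in> B}
    = (\<integral>\<^sup>+\<omega>. indicator A (X t \<omega>) * ennreal (measure (K (X t \<omega>)) B) \<partial>M)"
proof -
  interpret prob_space M
    using mc by (simp add: markov_chain_def)
  have X [measurable]: "X t \<in> measurable M S" for t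
    using mc by (simp add: markov_chain_def)
  note [measurable] = A B
  let ?F = "natural_filtration M S X t"
  let ?g = "\<lambda>\<omega>. indicator B (X (Suc t) \<omega>) :: real"
  let ?c = "real_cond_exp M ?F ?g"
  interpret finite_measure_subalgebra M ?F
    using subalgebra_natural_filtration(1)[of X, OF X] by unfold_locales
  have K: "AE \<omega> in M. ?c \<omega> = measure (K (X t \<omega>)) B"
    using mc B by (simp add: markov_chain_def)
  have XF [measurable]: "X t \<in> measurable ?F S"
    by (rule subalgebra_natural_filtration(2)[of X, OF X])
  have int: "integrable M (\<lambda>\<omega>. indicator A (X t \<omega>) * ?g \<omega>)"
    by (rule integrable_const_bound[of _ 1]) (auto split: split_indicator)
  have c: "integrable M (\<lambda>\<omega>. indicator A (X t \<omega>) * ?c \<omega>)"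
    "(\<integral>\<omega>. indicator A (X t \<omega>) * ?c \<omega> \<partial>M) = (\<integral>\<omega>. indicator A (X t \<omega>) * ?g \<omega> \<partial>M)"
    by (rule real_cond_exp_intg[OF int]; measurable)+
  have "(\<integral>\<^sup>+\<omega>. indicator A (X t \<omega>) * ennreal (measure (K (X t \<omega>)) B) \<partial>M)
    = (\<integral>\<^sup>+\<omega>. ennreal (indicator A (X t \<omega>) * ?c \<omega>) \<partial>M)"
    by (rule nn_integral_cong_AE) (use K in eventually_elim, auto split: split_indicator)
  also have "\<dots> = ennreal (\<integral>\<omega>. indicator A (X t \<omega>) * ?c \<omega> \<partial>M)"
    by (rule nn_integral_eq_integral[OF c(1)]) (use K in eventually_elim, auto split: split_indicator)
  also have "\<dots> = (\<integral>\<^sup>+\<omega>. ennreal (indicator A (X t \<omega>) * ?g \<omega>) \<partial>M)"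
    unfolding c(2) by (rule nn_integral_eq_integral[OF int, symmetric]) (auto split: split_indicator)
  also have "\<dots> = (\<integral>\<^sup>+\<omega>. indicator {\<omega> \<in> space M. X t \<omega> \<in> A \<and> X (Suc t) \<omega> \<in> B} \<omega> \<partial>M)"
    by (intro nn_integral_cong) (auto split: split_indicator)
  also have "\<dots> = emeasure M {\<omega> \<in> space M. X t \<omega> \<in> A \<and> X (Suc t) \<omega> \<in> B}"
    by (rule nn_integral_indicator) measurable
  finally show ?thesis ..
qed

text \<open>The joint law of \<open>X t\<close> and \<open>X (Suc t)\<close> and the measure with
  density \<open>split_density\<close> over the law of \<open>X t\<close> times Lebesgue measure
  agree on rectangles, hence everywhere. Letting \<open>u\<close> depend on both states covers the
  step size as well.\<close>

lemma split_chain_step: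
  fixes X :: "nat \<Rightarrow> 'a \<Rightarrow> real"
  assumes mc: "markov_chain M unit_interval (split_kernel p) X"
    and AE: "AE \<omega> in M. X t \<omega> \<in> {0<..<1}"
    and u: "(\<lambda>z. u (fst z) (snd z)) \<in> borel_measurable (borel \<Otimes>\<^sub>M borel)"
  shows "(\<integral>\<^sup>+\<omega>. u (X t \<omega>) (X (Suc t) \<omega>) \<partial>M)
    = (\<integral>\<^sup>+\<omega>. (\<integral>\<^sup>+y. u (X t \<omega>) y * ennreal (split_density p (X t \<omega>) y) \<partial>lborel) \<partial>M)"
proof -
  interpret prob_space M
    using mc by (simp add: markov_chain_def)
  have XS: "X t \<in> measurable M unit_interval" for t
    using mc by (simp add: markov_chain_def)
  have X [measurable]: "X t \<in> borel_measurable M" for t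
    using XS[of t] by (simp add: measurable_restrict_space2_iff)
  have range: "X t \<omega> \<in> {0..1}" if "\<omega> \<in> space M" for t \<omega>
    using measurable_space[OF XS that, of t] by (simp add: space_restrict_space)
  note [measurable] = u
  let ?P = "borel \<Otimes>\<^sub>M borel :: (real \<times> real) measure"
  let ?\<mu> = "distr M borel (X t)"
  interpret \<mu>: prob_space ?\<mu>
    by (rule prob_space_distr) measurable
  let ?J = "distr M ?P (\<lambda>\<omega>. (X t \<omega>, X (Suc t) \<omega>))"
  let ?R = "density (?\<mu> \<Otimes>\<^sub>M lborel) (\<lambda>z. ennreal (split_density p (fst z) (snd z)))"
  have R: "(\<integral>\<^sup>+z. v (fst z) (snd z) \<partial>?R)
      = (\<integral>\<^sup>+\<omega>. (\<integral>\<^sup>+y. v (X t \<omega>) y * ennreal (split_density p (X t \<omega>) y) \<partial>lborel) \<partial>M)"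
    if v [measurable]: "(\<lambda>z. v (fst z) (snd z)) \<in> borel_measurable ?P" for v
  proof -
    have "(\<integral>\<^sup>+z. v (fst z) (snd z) \<partial>?R) = (\<integral>\<^sup>+z. ennreal (split_density p (fst z) (snd z)) * v (fst z) (snd z) \<partial>(?\<mu> \<Otimes>\<^sub>M lborel))"
      by (rule nn_integral_density) measurable
    also have "\<dots> = (\<integral>\<^sup>+x. (\<integral>\<^sup>+y. ennreal (split_density p x y) * v x y \<partial>lborel) \<partial>?\<mu>)"
      by (subst lborel.nn_integral_fst[symmetric]) simp_all
    also have "\<dots> = (\<integral>\<^sup>+\<omega>. (\<integral>\<^sup>+y. ennreal (split_density p (X t \<omega>) y) * v (X t \<omega>) y \<partial>lborel) \<partial>M)"
      by (rule nn_integral_distr) measurable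
    finally show ?thesis
      by (simp add: mult.commute)
  qed
  have "?J = ?R"
  proof (rule measure_eqI_generator_eq[OF Int_stable_pair_measure_generator[of borel borel],
        where \<Omega> = UNIV and A = "\<lambda>_. UNIV"])
    fix C :: "(real \<times> real) set" assume "C \<in> {a \<times> b |a b. a \<in> sets borel \<and> b \<in> sets borel}"
    then obtain A B where C: "C = A \<times> B" and [measurable]: "A \<in> sets borel" "B \<in> sets borel"
      by auto
    \<comment> \<open>The Markov property speaks of measurable subsets of the state space, so both
      sides of the rectangle are cut down to \<open>{0..1}\<close>, where the chain lives.\<close>
    have "emeasure ?J C = emeasure M {\<omega> \<in> space M. X t \<omega> \<in> A \<inter> {0..1} \<and> X (Suc t) \<omega> \<in> B \<inter> {0..1}}"
      unfolding C using range by (subst emeasure_distr) (auto intro!: arg_cong[where f = "emeasure M"])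
    also have "\<dots> = (\<integral>\<^sup>+\<omega>. indicator (A \<inter> {0..1}) (X t \<omega>) * ennreal (measure (split_kernel p (X t \<omega>)) (B \<inter> {0..1})) \<partial>M)"
      by (rule markov_chain_joint[OF mc]) (auto simp: sets_restrict_space_iff)
    also have "\<dots> = (\<integral>\<^sup>+\<omega>. (\<integral>\<^sup>+y. indicator C (X t \<omega>, y) * ennreal (split_density p (X t \<omega>) y) \<partial>lborel) \<partial>M)"
    proof (rule nn_integral_cong_AE, use AE in eventually_elim)
      fix \<omega> assume x: "X t \<omega> \<in> {0<..<1}"
      have S: "B \<inter> {0..1} \<in> sets unit_interval"
        by (auto simp: sets_restrict_space_iff)
      have e: "emeasure (split_kernel p (X t \<omega>)) (B \<inter> {0..1})
        = (\<integral>\<^sup>+y. indicator B y * ennreal (split_density p (X t \<omega>) y) \<partial>lborel)"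
        using x by (subst emeasure_split_kernel[OF _ _ S])
          (auto intro!: nn_integral_cong simp: split_density_def split: split_indicator)
      \<comment> \<open>Finiteness of the total mass, computed with the antiderivative
        \<open>y\<close> of 1, permits the passage from the real-valued \<open>measure\<close> to
        \<open>emeasure\<close>.\<close>
      also have "\<dots> \<le> (\<integral>\<^sup>+y. ennreal 1 * ennreal (split_density p (X t \<omega>) y) \<partial>lborel)"
        by (intro nn_integral_mono) (auto split: split_indicator)
      also have "\<dots> = ennreal ((X t \<omega> powr (p - 1) * X t \<omega> + (1 - X t \<omega>) powr (p - 1) * (1 - X t \<omega>)) / power_sum p (X t \<omega>))"
        using x by (intro nn_integral_split_density) (auto intro!: tendsto_eq_intros)
      finally have "emeasure (split_kernel p (X t \<omega>)) (B \<inter> {0..1}) < \<top>"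
        by (rule le_less_trans) simp
      then have "ennreal (measure (split_kernel p (X t \<omega>)) (B \<inter> {0..1})) = emeasure (split_kernel p (X t \<omega>)) (B \<inter> {0..1})"
        by (simp add: emeasure_eq_ennreal_measure)
      with e x show "indicator (A \<inter> {0..1}) (X t \<omega>) * ennreal (measure (split_kernel p (X t \<omega>)) (B \<inter> {0..1}))
        = (\<integral>\<^sup>+y. indicator C (X t \<omega>, y) * ennreal (split_density p (X t \<omega>) y) \<partial>lborel)"
        by (auto simp: C indicator_times split: split_indicator)
    qed
    also have "\<dots> = (\<integral>\<^sup>+z. indicator C z \<partial>?R)"
      using R[of "\<lambda>x y. indicator C (x, y)"] by (simp add: C)
    also have "\<dots> = emeasure ?R C"
      by (rule nn_integral_indicator) (simp add: C)
    finally show "emeasure ?J C = emeasure ?R C" .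
  next
    interpret J: prob_space ?J
      by (rule prob_space_distr) measurable
    show "emeasure ?J UNIV \<noteq> \<infinity>"
      using J.emeasure_finite by (simp add: top.not_eq_extremum)
  next
    show "sets ?J = sigma_sets UNIV {a \<times> b |a b. a \<in> sets borel \<and> b \<in> sets borel}"
      by (simp add: sets_pair_measure)
    have "sets ?R = sets ?P"
      by (simp cong: sets_pair_measure_cong)
    then show "sets ?R = sigma_sets UNIV {a \<times> b |a b. a \<in> sets borel \<and> b \<in> sets borel}"
      by (simp add: sets_pair_measure)
  qed (auto intro!: exI[of _ UNIV])
  then have "(\<integral>\<^sup>+z. u (fst z) (snd z) \<partial>?J) = (\<integral>\<^sup>+z. u (fst z) (snd z) \<partial>?R)"
    by simp
  then show ?thesis
    by (simp add: R[OF u] nn_integral_distr)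
qed

text \<open>The density puts no mass outside the open interval, so the absorbing states are almost
  surely not hit in finite time; they appear only as limits.\<close>

lemma split_chain_interior:
  fixes X :: "nat \<Rightarrow> 'a \<Rightarrow> real"
  assumes mc: "markov_chain M unit_interval (split_kernel p) X"
    and X0: "AE \<omega> in M. X 0 \<omega> \<in> {0<..<1}"
  shows "AE \<omega> in M. X t \<omega> \<in> {0<..<1}"
proof (induction t)
  case 0
  show ?case by (rule X0)
next
  case (Suc t)
  have [measurable]: "X t \<in> borel_measurable M" for t
    using mc by (simp add: markov_chain_def measurable_restrict_space2_iff)
  have "(\<integral>\<^sup>+\<omega>. indicator (- {0<..<1}) (X (Suc t) \<omega>) \<partial>M)
    = (\<integral>\<^sup>+\<omega>. (\<integral>\<^sup>+y. indicator (- {0<..<1}) y * ennreal (split_density p (X t \<omega>) y) \<partial>lborel) \<partial>M)"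
    by (rule split_chain_step[OF mc Suc]) measurable
  also have "\<dots> = (\<integral>\<^sup>+\<omega>. 0 \<partial>M)"
  proof (rule nn_integral_cong_AE, use Suc in eventually_elim)
    fix \<omega> assume X: "X t \<omega> \<in> {0<..<1}"
    have "(\<integral>\<^sup>+y. indicator (- {0<..<1}) y * ennreal (split_density p (X t \<omega>) y) \<partial>lborel)
      = (\<integral>\<^sup>+y. 0 \<partial>(lborel :: real measure))"
      by (intro nn_integral_cong) (use X in \<open>auto simp: split_density_def split: split_indicator\<close>)
    then show "(\<integral>\<^sup>+y. indicator (- {0<..<1}) y * ennreal (split_density p (X t \<omega>) y) \<partial>lborel) = 0"
      by simp
  qed
  finally have "AE \<omega> in M. indicator (- {0<..<1}) (X (Suc t) \<omega>) = (0 :: ennreal)"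
    by (intro iffD1[OF nn_integral_0_iff_AE]) simp_all
  then show ?case
    by eventually_elim (auto split: split_indicator_asm)
qed

section \<open>Almost sure convergence and the law of the limit\<close>

context
  fixes p x :: real and M :: "'a measure" and X :: "nat \<Rightarrow> 'a \<Rightarrow> real"
  assumes p: "p < 0" and x: "0 < x" "x < 1"
    and mc: "markov_chain M unit_interval (split_kernel p) X"
    and X0: "AE \<omega> in M. X 0 \<omega> = x"
begin

interpretation prob_space M
  using mc by (simp add: markov_chain_def)

lemma split_chain_measurable [measurable]: "X t \<in> borel_measurable M"
  using mc by (simp add: markov_chain_def measurable_restrict_space2_iff)

lemma split_chain_started_interior: "AE \<omega> in M. X t \<omega> \<in> {0<..<1}"
  by (rule split_chain_interior[OF mc]) (use X0 in eventually_elim, use x in simp)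

lemma nn_integral_start:
  assumes [measurable]: "u \<in> borel_measurable borel"
  shows "(\<integral>\<^sup>+\<omega>. u (X 0 \<omega>) \<partial>M) = u x"
proof -
  have "(\<integral>\<^sup>+\<omega>. u (X 0 \<omega>) \<partial>M) = (\<integral>\<^sup>+\<omega>. u x \<partial>M)"
    by (rule nn_integral_cong_AE) (use X0 in eventually_elim, simp)
  then show ?thesis
    by (simp add: emeasure_space_1)
qed

text \<open>Harmonicity keeps the mean constant in time, which carries the value at the start over
  to the limit.\<close>

lemma expectation_limit_prob: "(\<integral>\<^sup>+\<omega>. ennreal (limit_prob p (X t \<omega>)) \<partial>M) = ennreal (limit_prob p x)"
proof (induction t)
  case 0
  show ?case by (rule nn_integral_start) measurable
next
  case (Suc t)
  have "(\<integral>\<^sup>+\<omega>. ennreal (limit_prob p (X (Suc t) \<omega>)) \<partial>M)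
    = (\<integral>\<^sup>+\<omega>. (\<integral>\<^sup>+y. ennreal (limit_prob p y) * ennreal (split_density p (X t \<omega>) y) \<partial>lborel) \<partial>M)"
    by (rule split_chain_step[OF mc split_chain_started_interior]) measurable
  also have "\<dots> = (\<integral>\<^sup>+\<omega>. ennreal (limit_prob p (X t \<omega>)) \<partial>M)"
    by (rule nn_integral_cong_AE, use split_chain_started_interior[of t] in eventually_elim)
       (simp add: limit_prob_harmonic p)
  finally show ?case
    by (simp add: Suc)
qed

text \<open>Telescoping \<open>potential_drop\<close>; discarding the remaining potential then
  bounds the total expected loss uniformly in \<open>n\<close>.\<close>

lemma sum_expected_loss_le:
  "(\<Sum>t<n. \<integral>\<^sup>+\<omega>. ennreal (loss p (X t \<omega>)) \<partial>M) + (\<integral>\<^sup>+\<omega>. ennreal (potential p (X n \<omega>)) \<partial>M)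
    = ennreal (potential p x)"
proof (induction n)
  case 0
  have "(\<integral>\<^sup>+\<omega>. ennreal (potential p (X 0 \<omega>)) \<partial>M) = ennreal (potential p x)"
    by (rule nn_integral_start) measurable
  then show ?case by simp
next
  case (Suc n)
  have "(\<integral>\<^sup>+\<omega>. ennreal (potential p (X (Suc n) \<omega>)) \<partial>M)
    = (\<integral>\<^sup>+\<omega>. (\<integral>\<^sup>+y. ennreal (potential p y) * ennreal (split_density p (X n \<omega>) y) \<partial>lborel) \<partial>M)"
    by (rule split_chain_step[OF mc split_chain_started_interior]) measurable
  then have "(\<integral>\<^sup>+\<omega>. ennreal (loss p (X n \<omega>)) \<partial>M) + (\<integral>\<^sup>+\<omega>. ennreal (potential p (X (Suc n) \<omega>)) \<partial>M)
    = (\<integral>\<^sup>+\<omega>. (\<integral>\<^sup>+y. ennreal (potential p y) * ennreal (split_density p (X n \<omega>) y) \<partial>lborel)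
        + ennreal (loss p (X n \<omega>)) \<partial>M)"
    by (subst nn_integral_add) (simp_all add: add.commute)
  also have "\<dots> = (\<integral>\<^sup>+\<omega>. ennreal (potential p (X n \<omega>)) \<partial>M)"
    by (rule nn_integral_cong_AE, use split_chain_started_interior[of n] in eventually_elim)
       (simp add: potential_drop p)
  finally show ?case
    using Suc by (simp add: add.assoc)
qed

lemma suminf_expected_loss_le:
  "(\<Sum>t. \<integral>\<^sup>+\<omega>. ennreal (loss p (X t \<omega>)) \<partial>M) \<le> ennreal (potential p x)"
proof (rule suminf_le_const)
  show "(\<Sum>t<n. \<integral>\<^sup>+\<omega>. ennreal (loss p (X t \<omega>)) \<partial>M) \<le> ennreal (potential p x)" for n
    using sum_expected_loss_le[of n] by (metis le_iff_add)
qed simp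

text \<open>The series has finite expectation, hence is almost surely finite.\<close>

lemma AE_summable_loss: "AE \<omega> in M. summable (\<lambda>t. loss p (X t \<omega>))"
proof -
  have "(\<integral>\<^sup>+\<omega>. (\<Sum>t. ennreal (loss p (X t \<omega>))) \<partial>M) \<le> ennreal (potential p x)"
    by (subst nn_integral_suminf) (simp_all add: suminf_expected_loss_le)
  then have "(\<integral>\<^sup>+\<omega>. (\<Sum>t. ennreal (loss p (X t \<omega>))) \<partial>M) \<noteq> \<infinity>"
    by (auto simp: top_unique)
  then have "AE \<omega> in M. (\<Sum>t. ennreal (loss p (X t \<omega>))) \<noteq> \<infinity>"
    by (intro nn_integral_noteq_infinite) measurable
  moreover have "AE \<omega> in M. \<forall>t. X t \<omega> \<in> {0<..<1}"
    unfolding AE_all_countable using split_chain_started_interior by blast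
  ultimately show ?thesis
    by eventually_elim (auto intro!: summable_suminf_not_top simp: less_imp_le loss_pos)
qed

text \<open>The expected total variation of the path is at most a constant times the total expected
  loss, so the increments are almost surely absolutely summable.\<close>

lemma AE_summable_steps: "AE \<omega> in M. summable (\<lambda>t. X (Suc t) \<omega> - X t \<omega>)"
proof -
  let ?c = "2 powr (- p - 1 / p)"
  have step: "(\<integral>\<^sup>+\<omega>. ennreal \<bar>X (Suc t) \<omega> - X t \<omega>\<bar> \<partial>M) \<le> ennreal ?c * (\<integral>\<^sup>+\<omega>. ennreal (loss p (X t \<omega>)) \<partial>M)" for t
  proof -
    have "(\<integral>\<^sup>+\<omega>. ennreal \<bar>X (Suc t) \<omega> - X t \<omega>\<bar> \<partial>M)
      = (\<integral>\<^sup>+\<omega>. (\<integral>\<^sup>+y. ennreal \<bar>y - X t \<omega>\<bar> * ennreal (split_density p (X t \<omega>) y) \<partial>lborel) \<partial>M)"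
      by (rule split_chain_step[OF mc split_chain_started_interior]) measurable
    also have "\<dots> \<le> (\<integral>\<^sup>+\<omega>. ennreal ?c * ennreal (loss p (X t \<omega>)) \<partial>M)"
    proof (rule nn_integral_mono_AE, use split_chain_started_interior[of t] in eventually_elim)
      fix \<omega> assume "X t \<omega> \<in> {0<..<1}"
      then show "(\<integral>\<^sup>+y. ennreal \<bar>y - X t \<omega>\<bar> * ennreal (split_density p (X t \<omega>) y) \<partial>lborel)
          \<le> ennreal ?c * ennreal (loss p (X t \<omega>))"
        using nn_integral_split_density_displacement[OF p, of "X t \<omega>"]
        by (simp add: ennreal_mult' powr_ge_zero)
    qed
    also have "\<dots> = ennreal ?c * (\<integral>\<^sup>+\<omega>. ennreal (loss p (X t \<omega>)) \<partial>M)"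
      by (rule nn_integral_cmult) measurable
    finally show ?thesis .
  qed
  have "(\<integral>\<^sup>+\<omega>. (\<Sum>t. ennreal \<bar>X (Suc t) \<omega> - X t \<omega>\<bar>) \<partial>M) = (\<Sum>t. \<integral>\<^sup>+\<omega>. ennreal \<bar>X (Suc t) \<omega> - X t \<omega>\<bar> \<partial>M)"
    by (rule nn_integral_suminf) measurable
  also have "\<dots> \<le> (\<Sum>t. ennreal ?c * (\<integral>\<^sup>+\<omega>. ennreal (loss p (X t \<omega>)) \<partial>M))"
    by (intro suminf_le step) simp_all
  also have "\<dots> \<le> ennreal ?c * ennreal (potential p x)"
    by (simp only: ennreal_suminf_cmult) (intro mult_left_mono suminf_expected_loss_le, simp)
  finally have "(\<integral>\<^sup>+\<omega>. (\<Sum>t. ennreal \<bar>X (Suc t) \<omega> - X t \<omega>\<bar>) \<partial>M) < \<infinity>"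
    by (rule le_less_trans) (simp add: ennreal_mult_less_top)
  then have "AE \<omega> in M. (\<Sum>t. ennreal \<bar>X (Suc t) \<omega> - X t \<omega>\<bar>) \<noteq> \<infinity>"
    by (intro nn_integral_noteq_infinite) auto
  then show ?thesis
    by eventually_elim (rule summable_rabs_cancel, rule summable_suminf_not_top, simp_all)
qed

text \<open>Summable increments give a limit, and summable losses tend to 0 along the path. An
  interior limit would contradict continuity and positivity of \<open>loss\<close>.\<close>

lemma AE_limit_zero_or_one:
  "AE \<omega> in M. ((\<lambda>t. X t \<omega>) \<longlonglongrightarrow> 0 \<or> (\<lambda>t. X t \<omega>) \<longlonglongrightarrow> 1) \<and> (\<forall>t. X t \<omega> \<in> {0<..<1})"
proof -
  have "AE \<omega> in M. \<forall>t. X t \<omega> \<in> {0<..<1}"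
    unfolding AE_all_countable using split_chain_started_interior by blast
  then show ?thesis
    using AE_summable_loss AE_summable_steps
  proof eventually_elim
    fix \<omega> assume X: "\<forall>t. X t \<omega> \<in> {0<..<1}" and loss: "summable (\<lambda>t. loss p (X t \<omega>))"
      and steps: "summable (\<lambda>t. X (Suc t) \<omega> - X t \<omega>)"
    have "(\<lambda>n. (\<Sum>t<n. X (Suc t) \<omega> - X t \<omega>) + X 0 \<omega>) \<longlonglongrightarrow> (\<Sum>t. X (Suc t) \<omega> - X t \<omega>) + X 0 \<omega>"
      by (intro tendsto_intros summable_LIMSEQ steps)
    then obtain l where l: "(\<lambda>t. X t \<omega>) \<longlonglongrightarrow> l"
      using sum_lessThan_telescope[of "\<lambda>t. X t \<omega>"] by simp
    have "0 \<le> l" "l \<le> 1"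
      using X by (auto intro!: LIMSEQ_le_const[OF l] LIMSEQ_le_const2[OF l] simp: less_imp_le)
    moreover have False if "0 < l" "l < 1"
    proof -
      have "(\<lambda>t. loss p (X t \<omega>)) \<longlonglongrightarrow> loss p l"
        by (rule isCont_tendsto_compose[OF isCont_loss[OF p that] l])
      then have "loss p l = 0"
        using summable_LIMSEQ_zero[OF loss] LIMSEQ_unique by blast
      then show False
        using loss_pos[OF that(1), of p] by simp
    qed
    ultimately show "((\<lambda>t. X t \<omega>) \<longlonglongrightarrow> 0 \<or> (\<lambda>t. X t \<omega>) \<longlonglongrightarrow> 1) \<and> (\<forall>t. X t \<omega> \<in> {0<..<1})"
      using l X by (metis less_eq_real_def)
  qed
qed

text \<open>Dominated convergence with bound 1: the means are constantly
  \<open>limit_prob p x\<close>, while the integrands converge to the indicator of the limit being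
  1.\<close>

lemma prob_limit_one:
  "prob {\<omega> \<in> space M. lim (\<lambda>t. X t \<omega>) = 1} = limit_prob p x"
proof -
  have [measurable]: "(\<lambda>\<omega>. lim (\<lambda>t. X t \<omega>)) \<in> borel_measurable M"
    by (rule borel_measurable_lim_metric) measurable
  let ?one = "{\<omega> \<in> space M. lim (\<lambda>t. X t \<omega>) = 1}"
  have "(\<lambda>t. \<integral>\<omega>. limit_prob p (X t \<omega>) \<partial>M) \<longlonglongrightarrow> (\<integral>\<omega>. indicator ?one \<omega> \<partial>M)"
  proof (rule integral_dominated_convergence[where w = "\<lambda>_. 1"])
    show "AE \<omega> in M. norm (limit_prob p (X t \<omega>)) \<le> 1" for t
      using split_chain_started_interior[of t]
      by eventually_elim (use limit_prob_bounds[OF p] in auto)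
    show "AE \<omega> in M. (\<lambda>t. limit_prob p (X t \<omega>)) \<longlonglongrightarrow> indicator ?one \<omega>"
      using AE_limit_zero_or_one AE_space
    proof eventually_elim
      fix \<omega>
      assume *: "((\<lambda>t. X t \<omega>) \<longlonglongrightarrow> 0 \<or> (\<lambda>t. X t \<omega>) \<longlonglongrightarrow> 1) \<and> (\<forall>t. X t \<omega> \<in> {0<..<1})"
        and \<omega>: "\<omega> \<in> space M"
      from * show "(\<lambda>t. limit_prob p (X t \<omega>)) \<longlonglongrightarrow> indicator ?one \<omega>"
      proof (elim conjE disjE)
        assume l: "(\<lambda>t. X t \<omega>) \<longlonglongrightarrow> 0"
        \<comment> \<open>The path must approach 0 from inside: \<open>limit_prob p 0\<close>
          evaluates to 1 through \<open>0 powr (p - 1) = 0\<close>, although the limit from the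
          right is 0. The endpoint 1 is similar.\<close>
        then have "filterlim (\<lambda>t. X t \<omega>) (at_right 0) sequentially"
          using * unfolding filterlim_at
          by (intro conjI always_eventually) (auto dest: spec less_imp_neq[THEN not_sym])
        with l show ?thesis
          using limI[OF l] by (auto intro: filterlim_compose[OF limit_prob_tendsto(1)[OF p]])
      next
        assume l: "(\<lambda>t. X t \<omega>) \<longlonglongrightarrow> 1"
        then have "filterlim (\<lambda>t. X t \<omega>) (at_left 1) sequentially"
          using * by (auto simp: filterlim_at intro!: always_eventually dest: less_imp_neq)
        with l show ?thesis
          using limI[OF l] \<omega> by (auto intro: filterlim_compose[OF limit_prob_tendsto(2)[OF p]])
      qed
    qed
  qed auto
  moreover have "(\<integral>\<omega>. limit_prob p (X t \<omega>) \<partial>M) = limit_prob p x" for t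
  proof -
    have "AE \<omega> in M. 0 \<le> limit_prob p (X t \<omega>)"
      using split_chain_started_interior[of t]
      by eventually_elim (use limit_prob_bounds[OF p] in auto)
    then show ?thesis
      using limit_prob_bounds[OF p x] by (subst integral_eq_nn_integral) (auto simp: expectation_limit_prob)
  qed
  ultimately show ?thesis
    by (simp add: LIMSEQ_const_iff)
qed

text \<open>The limit takes almost surely only the values 0 and 1, so \<open>prob_limit_one\<close>
  determines its law.\<close>

lemma distr_limit:
  "distr M borel (\<lambda>\<omega>. lim (\<lambda>t. X t \<omega>)) = Ber (limit_prob p x)"
proof -
  have [measurable]: "(\<lambda>\<omega>. lim (\<lambda>t. X t \<omega>)) \<in> borel_measurable M"
    by (rule borel_measurable_lim_metric) measurable
  let ?Y = "\<lambda>\<omega>. lim (\<lambda>t. X t \<omega>)"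
  let ?one = "{\<omega> \<in> space M. ?Y \<omega> = 1}"
  have r: "0 \<le> limit_prob p x" "limit_prob p x \<le> 1"
    by (rule limit_prob_bounds[OF p x])+
  have Y: "AE \<omega> in M. ?Y \<omega> = 0 \<or> ?Y \<omega> = 1"
    using AE_limit_zero_or_one by eventually_elim (auto dest: limI)
  have zero: "prob (space M - ?one) = 1 - limit_prob p x"
    by (subst prob_compl) (simp_all add: prob_limit_one)
  show ?thesis
  proof (rule measure_eqI)
    fix B assume "B \<in> sets (distr M borel ?Y)"
    then have [measurable]: "B \<in> sets borel"
      by simp
    have "emeasure (distr M borel ?Y) B = (\<integral>\<^sup>+\<omega>. indicator B (?Y \<omega>) \<partial>M)"
      using nn_integral_distr[of ?Y M borel "indicator B"] by simp
    also have "\<dots> = (\<integral>\<^sup>+\<omega>. indicator B 1 * indicator ?one \<omega> + indicator B 0 * indicator (space M - ?one) \<omega> \<partial>M)"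
      by (rule nn_integral_cong_AE, use Y AE_space in eventually_elim) auto
    also have "\<dots> = indicator B 1 * emeasure M ?one + indicator B 0 * emeasure M (space M - ?one)"
      by (subst nn_integral_add) (simp_all add: nn_integral_cmult_indicator)
    also have "\<dots> = indicator B 1 * ennreal (limit_prob p x) + indicator B 0 * ennreal (1 - limit_prob p x)"
      using zero prob_limit_one by (simp add: emeasure_eq_measure)
    \<comment> \<open>The bounds \<open>r\<close> enter here, because \<open>bernoulli_pmf\<close>
      clamps its parameter to \<open>[0, 1]\<close>.\<close>
    also have "\<dots> = (\<integral>\<^sup>+b. indicator B (of_bool b) \<partial>measure_pmf (bernoulli_pmf (limit_prob p x)))"
      using r by simp
    also have "\<dots> = emeasure (Ber (limit_prob p x)) B"
      using nn_integral_distr[of of_bool "measure_pmf (bernoulli_pmf (limit_prob p x))" borel "indicator B"]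
      by (simp add: Ber_def)
    finally show "emeasure (distr M borel ?Y) B = emeasure (Ber (limit_prob p x)) B" .
  qed (simp add: Ber_def)
qed

end

theorem theorem3p3:
  fixes p x :: real and M :: "'a measure" and X :: "nat \<Rightarrow> 'a \<Rightarrow> real"
  assumes "p < 0"
    and "0 < x" and "x < 1"
    and "markov_chain M unit_interval (split_kernel p) X"
    and "AE \<omega> in M. X 0 \<omega> = x"
  shows "limit_prob p x \<in> {0..1} \<and>
    (\<exists>Y \<in> borel_measurable M.
       (AE \<omega> in M. (\<lambda>t. X t \<omega>) \<longlonglongrightarrow> Y \<omega>) \<and>
       distr M borel Y = Ber (limit_prob p x))"
\<comment> \<open>As a witness, \<open>lim\<close> is a total function and is measurable even though
  convergence holds only almost everywhere.\<close>
proof (intro conjI bexI[of _ "\<lambda>\<omega>. lim (\<lambda>t. X t \<omega>)"])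
  show "limit_prob p x \<in> {0..1}"
    using limit_prob_bounds[OF assms(1-3)] by simp
  show "AE \<omega> in M. (\<lambda>t. X t \<omega>) \<longlonglongrightarrow> lim (\<lambda>t. X t \<omega>)"
    using AE_limit_zero_or_one[OF assms] by eventually_elim (auto dest: convergentI simp: convergent_LIMSEQ_iff)
  show "distr M borel (\<lambda>\<omega>. lim (\<lambda>t. X t \<omega>)) = Ber (limit_prob p x)"
    by (rule distr_limit[OF assms])
  show "(\<lambda>\<omega>. lim (\<lambda>t. X t \<omega>)) \<in> borel_measurable M"
    by (rule borel_measurable_lim_metric) (rule split_chain_measurable[OF assms])
qed

end
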